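(* Let $m\ge 2$ be an integer and $n=4m$. Then any structure learning algorithm for the constraint graph $F$ and the family of graphs $\mathcal{G}_n$ that succeeds with probability at least $2^{-(m-3)}$ requires at least $2^{m+1}$ samples.
   Context: $F$ is the constraint graph with vertex set $I_{32}\cup\{1,2,3,4\}$, where $I_{32}$ is a set of 32 vertices forming an independent set, every vertex of $I_{32}$ is adjacent to each of $1,2,3,4$, and additionally $\{1,2\},\{2,3\},\{3,4\}$ are edges; there are no other edges and no self-loops. An $F$-coloring of a graph $G=(V,E)$ is a map $\sigma:V\to V(F)$ with $\{\sigma(v),\sigma(w)\}\in E(F)$ for every $\{v,w\}\in E$; $\pi_G$ is the uniform distribution over the $F$-colorings of $G$. The graph $G_m=(V_m,E_m)$ has $V_m=\{a_i,a_i',b_i,c_i:1\le i\le m\}$ and $E_m=E_{1,1}\cup\bigcup_{i=1}^{m-1}E_{i,i+1}$, where $E_{1,1}=\{\{a_1,b_1\},\{a_1,c_1\},\{a_1',b_1\},\{a_1',c_1\},\{b_1,c_1\}\}$ and $E_{i,i+1}=\{\{a_i,b_{i+1}\},\{a_i,c_{i+1}\},\{a_i',b_{i+1}\},\{a_i',c_{i+1}\},\{b_i,a_{i+1}\},\{b_i,a_{i+1}'\},\{b_i,c_{i+1}\},\{c_i,a_{i+1}\},\{c_i,a_{i+1}'\},\{c_i,b_{i+1}\}\}$. Let $M=\{\{a_i,b_{i+2}\}:1\le i\le m-2\}$ and $\mathcal{G}_n=\{(V_m,E_m\cup S): S\subseteq M\}$. A structure learning algorithm for $F$ and $\mathcal{G}_n$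 receives $L$ independent samples from $\pi_G$ for an unknown $G\in\mathcal{G}_n$ and outputs $\hat G\in\mathcal{G}_n$; it succeeds with probability at least $p$ if $\Pr[\hat G=G]\ge p$ for every $G\in\mathcal{G}_n$. *)

theory Defs
  imports "HOL-Probability.Probability"
begin

(* Undirected graphs as a vertex set together with a set of edges {v, w};
   a self-loop at v would be the singleton {v}. *)
type_synonym 'v graph = "'v set \<times> 'v set set"

definition verts :: "'v graph \<Rightarrow> 'v set" where
  "verts G = fst G"

definition edges :: "'v graph \<Rightarrow> 'v set set" where
  "edges G = snd G"

(* Colorings are extensional functions (undefined outside the vertex set), so that each
   coloring of the vertices is represented by exactly one HOL function. *)
definition colorings :: "'c graph \<Rightarrow> 'v graph \<Rightarrow> ('v \<Rightarrow> 'c) set" where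
  "colorings F G =
     {\<sigma> \<in> verts G \<rightarrow>\<^sub>E verts F. \<forall>v w. {v, w} \<in> edges G \<longrightarrow> {\<sigma> v, \<sigma> w} \<in> edges F}"

(* pmf_of_set is only meaningful on finite nonempty sets; see
   colorings_graph_family below for the graphs of interest. *)
definition coloring_pmf :: "'c graph \<Rightarrow> 'v graph \<Rightarrow> ('v \<Rightarrow> 'c) pmf" where
  "coloring_pmf F G = pmf_of_set (colorings F G)"

(* A possibly randomized algorithm maps the list of samples to the distribution of its output;
   a deterministic one is the case where every value is a return_pmf. *)
definition structure_learning_algorithm ::
  "'c graph \<Rightarrow> 'v graph set \<Rightarrow> nat \<Rightarrow> (('v \<Rightarrow> 'c) list \<Rightarrow> 'v graph pmf) \<Rightarrow> bool" where
  "structure_learning_algorithm F \<G> L A \<longleftrightarrow>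
     (\<forall>G\<in>\<G>. \<forall>xs. length xs = L \<and> set xs \<subseteq> colorings F G \<longrightarrow> set_pmf (A xs) \<subseteq> \<G>)"

definition output_pmf ::
  "'c graph \<Rightarrow> nat \<Rightarrow> (('v \<Rightarrow> 'c) list \<Rightarrow> 'v graph pmf) \<Rightarrow> 'v graph \<Rightarrow> 'v graph pmf" where
  "output_pmf F L A G = bind_pmf (replicate_pmf L (coloring_pmf F G)) A"

definition succeeds_with_prob ::
  "'c graph \<Rightarrow> 'v graph set \<Rightarrow> nat \<Rightarrow> (('v \<Rightarrow> 'c) list \<Rightarrow> 'v graph pmf) \<Rightarrow> real \<Rightarrow> bool" where
  "succeeds_with_prob F \<G> L A p \<longleftrightarrow>
     (\<forall>G\<in>\<G>. measure_pmf.prob (output_pmf F L A G) {G} \<ge> p)"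

(* Ind k (k < 32) are the vertices of the independent set, Pth j (1 \<le> j \<le> 4) those of
   the path 1-2-3-4. *)
datatype color = Ind nat | Pth nat

definition constraint_graph :: "color graph" where
  "constraint_graph =
     (Ind ` {..<32} \<union> Pth ` {1..4},
      {{Ind k, Pth j} | k j. k < 32 \<and> j \<in> {1..4}} \<union>
      {{Pth 1, Pth 2}, {Pth 2, Pth 3}, {Pth 3, Pth 4}})"

datatype vertex = Va nat | Va' nat | Vb nat | Vc nat

definition base_verts :: "nat \<Rightarrow> vertex set" where
  "base_verts m = Va ` {1..m} \<union> Va' ` {1..m} \<union> Vb ` {1..m} \<union> Vc ` {1..m}"

definition first_edges :: "vertex set set" where
  "first_edges =
     {{Va 1, Vb 1}, {Va 1, Vc 1}, {Va' 1, Vb 1}, {Va' 1, Vc 1}, {Vb 1, Vc 1}}"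

definition step_edges :: "nat \<Rightarrow> vertex set set" where
  "step_edges i =
     {{Va i, Vb (i+1)}, {Va i, Vc (i+1)}, {Va' i, Vb (i+1)}, {Va' i, Vc (i+1)},
      {Vb i, Va (i+1)}, {Vb i, Va' (i+1)}, {Vb i, Vc (i+1)},
      {Vc i, Va (i+1)}, {Vc i, Va' (i+1)}, {Vc i, Vb (i+1)}}"

definition base_edges :: "nat \<Rightarrow> vertex set set" where
  "base_edges m = first_edges \<union> (\<Union>i\<in>{1..<m}. step_edges i)"

(* The condition i + 2 \<le> m is i \<le> m - 2 without truncated subtraction. *)
definition optional_edges :: "nat \<Rightarrow> vertex set set" where
  "optional_edges m = {{Va i, Vb (i+2)} | i. 1 \<le> i \<and> i + 2 \<le> m}"

(* Indexed by the number n = 4m of vertices. *)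
definition graph_family :: "nat \<Rightarrow> vertex graph set" where
  "graph_family n =
     {(base_verts m, base_edges m \<union> S) | m S. n = 4 * m \<and> S \<subseteq> optional_edges m}"

lemma card_verts_graph_family:
  assumes "G \<in> graph_family n"
  shows "card (verts G) = n"
proof -
  obtain m S where *: "G = (base_verts m, base_edges m \<union> S)" "n = 4 * m"
    using assms by (auto simp: graph_family_def)
  have "card (base_verts m) = 4 * m"
    unfolding base_verts_def
    by (subst card_Un_disjoint; (auto simp: card_image inj_on_def)?)+
  then show ?thesis using * by (simp add: verts_def)
qed

lemma colorings_graph_family:
  assumes "G \<in> graph_family n" "n > 0"
  shows "finite (colorings constraint_graph G)" "colorings constraint_graph G \<noteq> {}"
proof -
  obtain m S where G: "G = (base_verts m, base_edges m \<union> S)" "S \<subseteq> optional_edges m"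
    and m: "n = 4 * m"
    using assms by (auto simp: graph_family_def)
  have "finite (verts G \<rightarrow>\<^sub>E verts constraint_graph)"
    by (rule finite_PiE) (auto simp: G verts_def base_verts_def constraint_graph_def)
  then show "finite (colorings constraint_graph G)"
    by (rule finite_subset[rotated]) (auto simp: colorings_def)
  define f where "f = case_vertex (\<lambda>_. Ind 0) (\<lambda>_. Ind 0) (\<lambda>_. Pth 1) (\<lambda>_. Pth 2)"
  show "colorings constraint_graph G \<noteq> {}"
  proof -
    have m0: "m \<noteq> 0" using m assms(2) by simp
    have F: "{Ind 0, Pth 1} \<in> edges constraint_graph" "{Ind 0, Pth 2} \<in> edges constraint_graph"
      "{Pth 1, Pth 2} \<in> edges constraint_graph"
      unfolding edges_def constraint_graph_def by fastforce+
    then have F': "{Pth 1, Ind 0} \<in> edges constraint_graph" "{Pth 2, Ind 0} \<in> edges constraint_graph"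
      "{Pth 2, Pth 1} \<in> edges constraint_graph"
      by (simp_all add: insert_commute)
    have edge: "f ` e \<in> edges constraint_graph \<and> e \<subseteq> base_verts m" if "e \<in> edges G" for e
    proof -
      have "e \<in> base_edges m \<or> e \<in> optional_edges m"
        using that G by (auto simp: edges_def)
      then consider "e \<in> first_edges" | i where "i \<in> {1..<m}" "e \<in> step_edges i"
        | i where "1 \<le> i" "i + 2 \<le> m" "e = {Va i, Vb (i+2)}"
        unfolding base_edges_def optional_edges_def by blast
      then show ?thesis
        using m0
        by cases (auto simp: f_def first_edges_def step_edges_def base_verts_def
            F[unfolded One_nat_def] F'[unfolded One_nat_def])
    qed
    have "restrict f (base_verts m) \<in> colorings constraint_graph G"
      unfolding colorings_def
    proof (intro CollectI conjI allI impI)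
      show "restrict f (base_verts m) \<in> verts G \<rightarrow>\<^sub>E verts constraint_graph"
        by (auto simp: f_def G verts_def base_verts_def constraint_graph_def)
    next
      fix v w assume "{v, w} \<in> edges G"
      from edge[OF this]
      show "{restrict f (base_verts m) v, restrict f (base_verts m) w} \<in> edges constraint_graph"
        by auto
    qed
    then show ?thesis by blast
  qed
qed

end

theory Submission
  imports Defs
begin

text \<open>
  The constraint graph is properly 3-colored by the classes \<open>I\<^sub>3\<^sub>2\<close>, \<open>{1,3}\<close>, \<open>{2,4}\<close>, whereas
  \<open>G\<^sub>m\<close> has a unique proper 3-coloring up to renaming: the triangle \<open>a\<^sub>1 b\<^sub>1 c\<^sub>1\<close> determines it
  layer by layer. Hence in every coloring of \<open>G\<^sub>m\<close> the vertices \<open>a\<^sub>i, a\<^sub>i'\<close> share one class, the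
  \<open>b\<^sub>i\<close> another and the \<open>c\<^sub>i\<close> the third. If the class of the \<open>a\<^sub>i\<close> is \<open>I\<^sub>3\<^sub>2\<close>, all optional edges
  hold automatically, so these colorings are common to all graphs of the family; there are at
  least \<open>2 * 32^(2m)\<close> of them. In the remaining colorings only \<open>m\<close> vertices receive colors of
  \<open>I\<^sub>3\<^sub>2\<close>, so there are at most \<open>4 * 32^m * 2^(3m)\<close> of those, a fraction of at most \<open>2 / 4^m\<close>.

  Samples consisting of common colorings do not discriminate between the graphs: summed over the
  \<open>2^(m-2)\<close> graphs, they contribute at most 1 to the success probabilities. All other samples
  contribute at most \<open>L * 2 / 4^m\<close> per graph, and the sum has to reach \<open>2^(m-2) * 2^(-(m-3)) = 2\<close>.
\<close>

section \<open>Independent uniform samples and a general identification bound\<close>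

lemma pmf_replicate_pmf:
  "pmf (replicate_pmf n p) xs = (if length xs = n then prod_list (map (pmf p) xs) else 0)"
proof (induction n arbitrary: xs)
  case 0
  then show ?case by (auto simp: indicator_def)
next
  case (Suc n)
  have eq: "replicate_pmf (Suc n) p = map_pmf (\<lambda>(x, ys). x # ys) (pair_pmf p (replicate_pmf n p))"
    by (simp add: pair_pmf_def map_pmf_def bind_assoc_pmf bind_return_pmf)
  show ?case
  proof (cases xs)
    case Nil
    then show ?thesis by (auto simp: pmf_eq_0_set_pmf set_replicate_pmf)
  next
    case (Cons y ys)
    have "inj (\<lambda>(x :: 'a, ys). x # ys)"
      by (auto intro!: injI)
    then have "pmf (map_pmf (\<lambda>(x, ys). x # ys) (pair_pmf p (replicate_pmf n p))) ((\<lambda>(x, ys). x # ys) (y, ys))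
      = pmf (pair_pmf p (replicate_pmf n p)) (y, ys)"
      by (rule pmf_map_inj')
    then show ?thesis
      unfolding eq using Cons by (simp add: pmf_pair Suc.IH)
  qed
qed

text \<open>Turns probabilities over independent uniform samples into averages over a finite set of
  sample lists, so that the bounds below become counting arguments.\<close>

lemma replicate_pmf_of_set:
  assumes "finite \<Omega>" "\<Omega> \<noteq> {}"
  shows "replicate_pmf n (pmf_of_set \<Omega>) = pmf_of_set {xs. set xs \<subseteq> \<Omega> \<and> length xs = n}"
    (is "_ = pmf_of_set ?X")
proof (rule pmf_eqI)
  fix xs
  obtain x where "x \<in> \<Omega>" using assms by auto
  then have "replicate n x \<in> ?X" by (auto simp: set_replicate_conv_if)
  then have "?X \<noteq> {}" by blast
  then have "pmf (pmf_of_set ?X) xs = indicator ?X xs / real (card \<Omega>) ^ n"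
    using assms by (simp add: finite_lists_length_eq card_lists_length_eq)
  moreover have "prod_list (map (pmf (pmf_of_set \<Omega>)) xs)
      = (if set xs \<subseteq> \<Omega> then 1 / real (card \<Omega>) ^ length xs else 0)"
    using assms by (induction xs) auto
  ultimately show "pmf (replicate_pmf n (pmf_of_set \<Omega>)) xs = pmf (pmf_of_set ?X) xs"
    by (simp add: pmf_replicate_pmf indicator_def)
qed

text \<open>The sample lists are split according to whether all entries lie in \<open>T\<close>. The
  first summand is normalized by \<open>card T ^ L\<close> instead of
  \<open>card \<Omega> ^ L\<close>: this only enlarges it and makes it independent of
  \<open>\<Omega>\<close>, so that it can later be added up over several sets
  \<open>\<Omega>\<close> containing \<open>T\<close>. The second summand is a union-type bound for
  the event that some sample falls outside \<open>T\<close>.\<close>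

lemma pmf_bind_replicate_pmf_of_set_le:
  fixes L :: nat
  assumes fin: "finite \<Omega>" and T: "T \<subseteq> \<Omega>" "T \<noteq> {}"
  defines "X \<equiv> {xs. set xs \<subseteq> T \<and> length xs = L}"
  shows "pmf (bind_pmf (replicate_pmf L (pmf_of_set \<Omega>)) A) y
    \<le> (\<Sum>xs\<in>X. pmf (A xs) y) / card T ^ L + L * (card (\<Omega> - T) / card T)"
proof -
  let ?Y = "{xs. set xs \<subseteq> \<Omega> \<and> length xs = L}"
  have finT: "finite T" using fin T(1) finite_subset by blast
  have t: "card T > 0" using finT T(2) by (simp add: card_gt_0_iff)
  have tw: "card T \<le> card \<Omega>" using fin T(1) card_mono by blast
  have w: "card \<Omega> > 0" using t tw by simp
  have finX: "finite X" and finY: "finite ?Y"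
    using finT fin by (simp_all add: X_def finite_lists_length_eq)
  have cX: "card X = card T ^ L" and cY: "card ?Y = card \<Omega> ^ L"
    using finT fin by (simp_all add: X_def card_lists_length_eq)
  have XY: "X \<subseteq> ?Y" using T by (auto simp: X_def)
  have "?Y \<noteq> {}" using cY w by (metis card.empty power_not_zero less_numeral_extra(3))
  have diff: "card (?Y - X) = card \<Omega> ^ L - card T ^ L"
    using card_Diff_subset[OF finX XY] cX cY by simp
  \<comment> \<open>On lists that leave \<open>T\<close> nothing is assumed about \<open>A\<close>;
    each output probability is bounded by 1.\<close>
  have "(\<Sum>xs\<in>?Y - X. pmf (A xs) y) \<le> (\<Sum>xs\<in>?Y - X. 1)"
    by (intro sum_mono pmf_le_1)
  also have "\<dots> = real (card \<Omega>) ^ L - real (card T) ^ L"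
    using diff tw by (simp add: of_nat_diff power_mono)
  finally have rest: "(\<Sum>xs\<in>?Y - X. pmf (A xs) y) \<le> real (card \<Omega>) ^ L - real (card T) ^ L" .
  have "(\<Sum>xs\<in>?Y. pmf (A xs) y) = (\<Sum>xs\<in>?Y - X. pmf (A xs) y) + (\<Sum>xs\<in>X. pmf (A xs) y)"
    by (rule sum.subset_diff[OF XY finY])
  with rest have "(\<Sum>xs\<in>?Y. pmf (A xs) y)
      \<le> (\<Sum>xs\<in>X. pmf (A xs) y) + (real (card \<Omega>) ^ L - real (card T) ^ L)"
    by linarith
  then have "(\<Sum>xs\<in>?Y. pmf (A xs) y) / real (card \<Omega>) ^ L
      \<le> ((\<Sum>xs\<in>X. pmf (A xs) y) + (real (card \<Omega>) ^ L - real (card T) ^ L)) / real (card \<Omega>) ^ L"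
    by (intro divide_right_mono) auto
  also have "\<dots> = (\<Sum>xs\<in>X. pmf (A xs) y) / real (card \<Omega>) ^ L + (1 - (real (card T) / card \<Omega>) ^ L)"
    using w by (simp add: add_divide_distrib diff_divide_distrib power_divide)
  also have "\<dots> \<le> (\<Sum>xs\<in>X. pmf (A xs) y) / card T ^ L + L * (card (\<Omega> - T) / card T)"
  proof (rule add_mono)
    show "(\<Sum>xs\<in>X. pmf (A xs) y) / real (card \<Omega>) ^ L \<le> (\<Sum>xs\<in>X. pmf (A xs) y) / card T ^ L"
      using t tw by (auto intro!: divide_left_mono sum_nonneg power_mono)
    have cd: "real (card (\<Omega> - T)) = real (card \<Omega>) - real (card T)"
      using card_Diff_subset[OF finT T(1)] tw by (simp add: of_nat_diff)
    \<comment> \<open>Bernoulli's inequality with increment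
      \<open>card T / card \<Omega> - 1\<close>, which is at least -1.\<close>
    have "1 + real L * (real (card T) / card \<Omega> - 1) \<le> (1 + (real (card T) / card \<Omega> - 1)) ^ L"
      by (rule Bernoulli_inequality) simp
    then have "1 - (real (card T) / card \<Omega>) ^ L \<le> L * (1 - real (card T) / card \<Omega>)"
      by (simp add: algebra_simps)
    also have "\<dots> = L * (real (card (\<Omega> - T)) / card \<Omega>)"
      using w cd by (simp add: diff_divide_distrib)
    also have "\<dots> \<le> L * (real (card (\<Omega> - T)) / card T)"
      using t tw by (intro mult_left_mono divide_left_mono) auto
    finally show "1 - (real (card T) / card \<Omega>) ^ L \<le> L * (card (\<Omega> - T) / card T)" by simp
  qed
  finally show ?thesis
    using fin T \<open>?Y \<noteq> {}\<close> finY cY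
    by (subst replicate_pmf_of_set) (auto simp: pmf_bind_pmf_of_set)
qed

text \<open>A list of elements of \<open>T\<close> can arise from every \<open>G\<close>, and
  \<open>A\<close> answers it with one and the same distribution; the probabilities of the different
  answers \<open>G\<close> add up to at most 1. Averaging over such lists gives the 1, and every
  \<open>G\<close> adds at most \<open>L * \<epsilon>\<close> for the remaining lists.\<close>

lemma sum_identification_prob_le:
  fixes \<epsilon> :: real
  assumes fin: "finite \<G>"
    and \<Omega>: "\<And>G. G \<in> \<G> \<Longrightarrow> finite (\<Omega> G) \<and> T \<subseteq> \<Omega> G"
    and T: "finite T" "T \<noteq> {}"
    and \<epsilon>: "\<And>G. G \<in> \<G> \<Longrightarrow> card (\<Omega> G - T) \<le> \<epsilon> * card T"
  shows "(\<Sum>G\<in>\<G>. pmf (bind_pmf (replicate_pmf L (pmf_of_set (\<Omega> G))) A) G)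
    \<le> 1 + card \<G> * (L * \<epsilon>)"
proof -
  define X where "X = {xs. set xs \<subseteq> T \<and> length xs = L}"
  have t: "card T > 0" using T by (simp add: card_gt_0_iff)
  have cX: "card X = card T ^ L" using T by (simp add: X_def card_lists_length_eq)
  have "(\<Sum>G\<in>\<G>. pmf (bind_pmf (replicate_pmf L (pmf_of_set (\<Omega> G))) A) G)
      \<le> (\<Sum>G\<in>\<G>. (\<Sum>xs\<in>X. pmf (A xs) G) / card T ^ L + L * \<epsilon>)"
  proof (rule sum_mono)
    fix G assume G: "G \<in> \<G>"
    have "card (\<Omega> G - T) / card T \<le> \<epsilon>"
      using \<epsilon>[OF G] t by (simp add: field_simps)
    then have "L * (card (\<Omega> G - T) / card T) \<le> L * \<epsilon>"
      by (intro mult_left_mono) auto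
    with pmf_bind_replicate_pmf_of_set_le[of "\<Omega> G" T L A G] \<Omega>[OF G] T(2)
    show "pmf (bind_pmf (replicate_pmf L (pmf_of_set (\<Omega> G))) A) G
        \<le> (\<Sum>xs\<in>X. pmf (A xs) G) / card T ^ L + L * \<epsilon>"
      unfolding X_def by simp
  qed
  also have "\<dots> = (\<Sum>xs\<in>X. \<Sum>G\<in>\<G>. pmf (A xs) G) / card T ^ L + card \<G> * (L * \<epsilon>)"
    \<comment> \<open>Exchanging the sums fixes a sample list first, so that the inner sum ranges
      over the possible answers to it.\<close>
    by (simp add: sum.distrib sum_divide_distrib[symmetric] sum.swap[of _ X])
  also have "(\<Sum>xs\<in>X. \<Sum>G\<in>\<G>. pmf (A xs) G) \<le> (\<Sum>xs\<in>X. 1)"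
  proof (rule sum_mono)
    fix xs
    show "(\<Sum>G\<in>\<G>. pmf (A xs) G) \<le> 1"
      using measure_measure_pmf_finite[OF fin, of "A xs"] measure_pmf.prob_le_1[of "A xs" \<G>]
      by simp
  qed
  then have "(\<Sum>xs\<in>X. \<Sum>G\<in>\<G>. pmf (A xs) G) / card T ^ L \<le> 1"
    using t cX by (simp add: field_simps)
  finally show ?thesis by simp
qed

section \<open>The constraint graph and its homomorphism to the triangle\<close>

lemma constraint_graph_edge_iff:
  "{x, y} \<in> edges constraint_graph \<longleftrightarrow>
    (\<exists>k j. k < 32 \<and> j \<in> {1..4} \<and> ((x = Ind k \<and> y = Pth j) \<or> (x = Pth j \<and> y = Ind k))) \<or>
    (\<exists>j. j \<in> {1..3} \<and> ((x = Pth j \<and> y = Pth (j+1)) \<or> (x = Pth (j+1) \<and> y = Pth j)))"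
proof -
  have *: "{1..3::nat} = {1,2,3}" by auto
  show ?thesis
    unfolding constraint_graph_def edges_def *
    by (auto simp: doubleton_eq_iff)
qed

primrec color_class :: "color \<Rightarrow> nat" where
  "color_class (Ind k) = 0"
| "color_class (Pth j) = (if odd j then 1 else 2)"

lemma color_class_le_2: "color_class x \<le> 2"
  by (cases x) auto

lemma color_class_edge:
  "{x, y} \<in> edges constraint_graph \<Longrightarrow> color_class x \<noteq> color_class y"
  unfolding constraint_graph_edge_iff by (auto split: if_splits)

lemma color_class_fiber:
  "{x \<in> verts constraint_graph. color_class x = 0} = Ind ` {..<32}"
  "{x \<in> verts constraint_graph. color_class x = 1} = {Pth 1, Pth 3}"
  "{x \<in> verts constraint_graph. color_class x = 2} = {Pth 2, Pth 4}"
proof -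
  have *: "{1..4::nat} = {1,2,3,4}" by auto
  show
    "{x \<in> verts constraint_graph. color_class x = 0} = Ind ` {..<32}"
    "{x \<in> verts constraint_graph. color_class x = 1} = {Pth 1, Pth 3}"
    "{x \<in> verts constraint_graph. color_class x = 2} = {Pth 2, Pth 4}"
    unfolding verts_def constraint_graph_def * by (auto split: if_splits)
qed

text \<open>Polymorphic because it serves two purposes: with sets of colors it describes product
  sets of maps, and with numbers it describes the class of each vertex.\<close>

primrec layer_pattern :: "'b \<Rightarrow> 'b \<Rightarrow> 'b \<Rightarrow> vertex \<Rightarrow> 'b" where
  "layer_pattern x y z (Va i) = x"
| "layer_pattern x y z (Va' i) = x"
| "layer_pattern x y z (Vb i) = y"
| "layer_pattern x y z (Vc i) = z"

lemma finite_base_verts [simp]: "finite (base_verts m)"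
  by (simp add: base_verts_def)

lemma card_PiE_layer_pattern:
  "card (PiE (base_verts m) (layer_pattern X Y Z)) = (card X ^ 2 * card Y * card Z) ^ m"
proof -
  have "card (PiE (base_verts m) (layer_pattern X Y Z))
      = (\<Prod>v\<in>base_verts m. card (layer_pattern X Y Z v))"
    by (simp add: card_PiE)
  also have "\<dots> = card X ^ m * card X ^ m * card Y ^ m * card Z ^ m"
    unfolding base_verts_def
    by ((subst prod.union_disjoint, simp, simp, force)+, simp add: prod.reindex inj_on_def)
  finally show ?thesis by (simp add: power_mult_distrib power2_eq_square)
qed

section \<open>Rigidity of the proper 3-colorings of the base graph\<close>

lemma third_of_three:
  fixes x y p q :: nat
  assumes "p \<noteq> q" "x \<noteq> p" "x \<noteq> q" "y \<noteq> p" "y \<noteq> q" "x \<le> 2" "y \<le> 2" "p \<le> 2" "q \<le> 2"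
  shows "x = y"
proof -
  have "v = 0 \<or> v = 1 \<or> v = 2" if "v \<le> 2" for v :: nat
    using that by linarith
  from this[OF assms(6)] this[OF assms(7)] this[OF assms(8)] this[OF assms(9)] assms(1-5)
  show ?thesis by (elim disjE) simp_all
qed

text \<open>Induction on the layers. Each vertex of layer \<open>j + 1\<close> is adjacent to
  vertices of layer \<open>j\<close> of the two other kinds; these have distinct colors by
  induction, so only the color of its own kind is left. In layer 1, \<open>Va' 1\<close> is forced
  by \<open>Vb 1\<close> and \<open>Vc 1\<close> in the same way.\<close>

lemma base_edges_properly_3_colored:
  fixes c :: "vertex \<Rightarrow> nat"
  assumes proper: "\<And>v w. {v, w} \<in> base_edges m \<Longrightarrow> c v \<noteq> c w"
    and le: "\<And>v. v \<in> base_verts m \<Longrightarrow> c v \<le> 2"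
    and i: "1 \<le> i" "i \<le> m"
  shows "c (Va i) = c (Va 1) \<and> c (Va' i) = c (Va 1) \<and> c (Vb i) = c (Vb 1) \<and> c (Vc i) = c (Vc 1)"
  using i
proof (induction i rule: dec_induct)
  case base
  have neq: "c (Va 1) \<noteq> c (Vb 1)" "c (Va 1) \<noteq> c (Vc 1)" "c (Va' 1) \<noteq> c (Vb 1)"
    "c (Va' 1) \<noteq> c (Vc 1)" "c (Vb 1) \<noteq> c (Vc 1)"
    by (rule proper; simp add: base_edges_def first_edges_def)+
  have le2: "c (Va 1) \<le> 2" "c (Va' 1) \<le> 2" "c (Vb 1) \<le> 2" "c (Vc 1) \<le> 2"
    using base.prems by (auto intro!: le simp: base_verts_def)
  have "c (Va' 1) = c (Va 1)"
    by (rule third_of_three[of "c (Vb 1)" "c (Vc 1)"]; fact neq le2)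
  then show ?case by simp
next
  case (step j)
  have IH: "c (Va j) = c (Va 1)" "c (Vb j) = c (Vb 1)" "c (Vc j) = c (Vc 1)"
    using step.IH step.prems by simp_all
  have 1: "c (Va 1) \<noteq> c (Vb 1)" "c (Va 1) \<noteq> c (Vc 1)" "c (Vb 1) \<noteq> c (Vc 1)"
    by (rule proper; simp add: base_edges_def first_edges_def)+
  have 2: "c (Va 1) \<le> 2" "c (Vb 1) \<le> 2" "c (Vc 1) \<le> 2" "c (Va (Suc j)) \<le> 2"
    "c (Va' (Suc j)) \<le> 2" "c (Vb (Suc j)) \<le> 2" "c (Vc (Suc j)) \<le> 2"
    using step.hyps step.prems by (auto intro!: le simp: base_verts_def)
  have sub: "e \<in> base_edges m" if "e \<in> step_edges j" for e
    using that step by (auto simp: base_edges_def)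
  have "c (Va j) \<noteq> c (Vb (Suc j))" "c (Va j) \<noteq> c (Vc (Suc j))"
    "c (Vb j) \<noteq> c (Va (Suc j))" "c (Vb j) \<noteq> c (Va' (Suc j))" "c (Vb j) \<noteq> c (Vc (Suc j))"
    "c (Vc j) \<noteq> c (Va (Suc j))" "c (Vc j) \<noteq> c (Va' (Suc j))" "c (Vc j) \<noteq> c (Vb (Suc j))"
    by (rule proper, rule sub, simp add: step_edges_def)+
  note * = this[unfolded IH]
  \<comment> \<open>Both orientations are supplied because \<open>third_of_three\<close> wants the
    excluded colors on the right.\<close>
  note facts = 1 2 * 1[THEN not_sym] *[THEN not_sym]
  have "c (Va (Suc j)) = c (Va 1)" "c (Va' (Suc j)) = c (Va 1)"
    by (rule third_of_three[of "c (Vb 1)" "c (Vc 1)"]; fact facts)+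
  moreover have "c (Vb (Suc j)) = c (Vb 1)"
    by (rule third_of_three[of "c (Va 1)" "c (Vc 1)"]; fact facts)
  moreover have "c (Vc (Suc j)) = c (Vc 1)"
    by (rule third_of_three[of "c (Va 1)" "c (Vb 1)"]; fact facts)
  ultimately show ?case by simp
qed

section \<open>Colorings common to the whole family, and the two counts\<close>

definition common_colorings :: "nat \<Rightarrow> (vertex \<Rightarrow> color) set" where
  "common_colorings m = {\<sigma> \<in> colorings constraint_graph (base_verts m, base_edges m).
     \<forall>i\<in>{1..m}. color_class (\<sigma> (Va i)) = 0}"

lemma base_coloring_classes:
  assumes \<sigma>: "\<sigma> \<in> colorings constraint_graph (base_verts m, base_edges m)"
    and i: "1 \<le> i" "i \<le> m"
  shows "color_class (\<sigma> (Va i)) = color_class (\<sigma> (Va 1))"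
    "color_class (\<sigma> (Va' i)) = color_class (\<sigma> (Va 1))"
    "color_class (\<sigma> (Vb i)) = color_class (\<sigma> (Vb 1))"
    "color_class (\<sigma> (Vc i)) = color_class (\<sigma> (Vc 1))"
proof -
  have "\<And>v w. {v, w} \<in> base_edges m \<Longrightarrow> color_class (\<sigma> v) \<noteq> color_class (\<sigma> w)"
    using \<sigma> by (auto simp: colorings_def edges_def[of "(_, _)"] dest: color_class_edge)
  from base_edges_properly_3_colored[of m "\<lambda>v. color_class (\<sigma> v)", OF this color_class_le_2 i]
  show "color_class (\<sigma> (Va i)) = color_class (\<sigma> (Va 1))"
    "color_class (\<sigma> (Va' i)) = color_class (\<sigma> (Va 1))"
    "color_class (\<sigma> (Vb i)) = color_class (\<sigma> (Vb 1))"
    "color_class (\<sigma> (Vc i)) = color_class (\<sigma> (Vc 1))"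
    by simp_all
qed

lemma base_coloring_triangle:
  assumes \<sigma>: "\<sigma> \<in> colorings constraint_graph (base_verts m, base_edges m)"
  shows "color_class (\<sigma> (Va 1)) \<noteq> color_class (\<sigma> (Vb 1))"
    "color_class (\<sigma> (Va 1)) \<noteq> color_class (\<sigma> (Vc 1))"
    "color_class (\<sigma> (Vb 1)) \<noteq> color_class (\<sigma> (Vc 1))"
proof -
  have *: "color_class (\<sigma> v) \<noteq> color_class (\<sigma> w)" if "{v, w} \<in> base_edges m" for v w
    using \<sigma> that by (auto simp: colorings_def edges_def[of "(_, _)"] dest: color_class_edge)
  show "color_class (\<sigma> (Va 1)) \<noteq> color_class (\<sigma> (Vb 1))"
    "color_class (\<sigma> (Va 1)) \<noteq> color_class (\<sigma> (Vc 1))"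
    "color_class (\<sigma> (Vb 1)) \<noteq> color_class (\<sigma> (Vc 1))"
    by (rule *; simp add: base_edges_def first_edges_def)+
qed

lemma edge_Ind_Pth:
  assumes "x \<in> verts constraint_graph" "y \<in> verts constraint_graph"
    and "color_class x = 0" "color_class y \<noteq> 0"
  shows "{x, y} \<in> edges constraint_graph" "{y, x} \<in> edges constraint_graph"
  using assms unfolding constraint_graph_edge_iff
  by (cases x; cases y; auto simp: verts_def constraint_graph_def split: if_splits)+

text \<open>An optional edge joins an \<open>a\<close> to a \<open>b\<close>. In a common coloring
  the former gets a color of the independent set and the latter one of the path, and all such pairs
  are edges of the constraint graph.\<close>

lemma common_colorings_subset:
  assumes "S \<subseteq> optional_edges m"
  shows "common_colorings m \<subseteq> colorings constraint_graph (base_verts m, base_edges m \<union> S)"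
proof
  fix \<sigma> assume "\<sigma> \<in> common_colorings m"
  then have \<sigma>: "\<sigma> \<in> colorings constraint_graph (base_verts m, base_edges m)"
    and a: "\<And>i. 1 \<le> i \<Longrightarrow> i \<le> m \<Longrightarrow> color_class (\<sigma> (Va i)) = 0"
    by (auto simp: common_colorings_def)
  have V: "\<And>v. v \<in> base_verts m \<Longrightarrow> \<sigma> v \<in> verts constraint_graph"
    and ext: "\<sigma> \<in> base_verts m \<rightarrow>\<^sub>E verts constraint_graph"
    and E: "\<And>v w. {v, w} \<in> base_edges m \<Longrightarrow> {\<sigma> v, \<sigma> w} \<in> edges constraint_graph"
    using \<sigma> by (auto simp: colorings_def verts_def[of "(_, _)"] edges_def[of "(_, _)"])
  have S: "{\<sigma> v, \<sigma> w} \<in> edges constraint_graph" if vwS: "{v, w} \<in> S" for v w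
  proof -
    obtain i where i: "1 \<le> i" "i + 2 \<le> m" and vw: "{v, w} = {Va i, Vb (i + 2)}"
      using vwS assms unfolding optional_edges_def by blast
    \<comment> \<open>By rigidity \<open>Vb (i + 2)\<close> has the class of \<open>Vb 1\<close>,
      which differs from the class 0 of \<open>Va 1\<close>.\<close>
    have "color_class (\<sigma> (Vb (i + 2))) \<noteq> 0"
      using base_coloring_classes(3)[OF \<sigma>, of "i + 2"] base_coloring_triangle(1)[OF \<sigma>] a[of 1] i
      by simp
    moreover have "\<sigma> (Va i) \<in> verts constraint_graph" "\<sigma> (Vb (i + 2)) \<in> verts constraint_graph"
      using i by (auto intro!: V simp: base_verts_def)
    ultimately show ?thesis
      using vw a[of i] i edge_Ind_Pth by (auto simp: doubleton_eq_iff)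
  qed
  show "\<sigma> \<in> colorings constraint_graph (base_verts m, base_edges m \<union> S)"
    using ext E S by (auto simp: colorings_def verts_def[of "(_, _)"] edges_def[of "(_, _)"])
qed

lemma finite_base_colorings: "finite (colorings constraint_graph (base_verts m, E))"
proof (rule finite_subset)
  show "colorings constraint_graph (base_verts m, E) \<subseteq> base_verts m \<rightarrow>\<^sub>E verts constraint_graph"
    by (auto simp: colorings_def verts_def[of "(_, _)"])
  show "finite (base_verts m \<rightarrow>\<^sub>E verts constraint_graph)"
    by (intro finite_PiE) (auto simp: verts_def constraint_graph_def)
qed

text \<open>Fix the color of all \<open>Vb i\<close> to one of the path vertices 1, 2 and that of
  all \<open>Vc i\<close> to the other. The \<open>2 * m\<close> vertices \<open>Va i\<close> and
  \<open>Va' i\<close> may then take any of the 32 independent colors, which gives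
  \<open>32 ^ 2 = 1024\<close> choices per layer for each of the two assignments.\<close>

lemma card_common_colorings_ge:
  assumes "m \<ge> 1"
  shows "2 * 1024 ^ m \<le> card (common_colorings m)"
proof -
  define P where "P y z = PiE (base_verts m) (layer_pattern (Ind ` {..<32}) {Pth y} {Pth z})" for y z
  have card_P: "card (P y z) = 1024 ^ m" for y z
    unfolding P_def card_PiE_layer_pattern by (simp add: card_image inj_on_def)
  have sub: "P y z \<subseteq> common_colorings m" if yz: "(y, z) \<in> {(1, 2), (2, 1)}" for y z
  proof
    fix \<sigma> assume \<sigma>: "\<sigma> \<in> P y z"
    have vals: "\<sigma> (Va i) \<in> Ind ` {..<32}" "\<sigma> (Va' i) \<in> Ind ` {..<32}"
      "\<sigma> (Vb i) = Pth y" "\<sigma> (Vc i) = Pth z" if "1 \<le> i" "i \<le> m" for i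
      using PiE_mem[OF \<sigma>[unfolded P_def], of "Va i"] PiE_mem[OF \<sigma>[unfolded P_def], of "Va' i"]
        PiE_mem[OF \<sigma>[unfolded P_def], of "Vb i"] PiE_mem[OF \<sigma>[unfolded P_def], of "Vc i"] that
      by (auto simp: base_verts_def)
    have ext: "\<sigma> \<in> base_verts m \<rightarrow>\<^sub>E verts constraint_graph"
    proof (rule PiE_I)
      fix v assume "v \<in> base_verts m"
      then show "\<sigma> v \<in> verts constraint_graph"
        using vals yz by (auto simp: base_verts_def verts_def constraint_graph_def)
    next
      fix v assume "v \<notin> base_verts m"
      then show "\<sigma> v = undefined" using \<sigma> by (auto simp: P_def)
    qed
    have IP: "{x, Pth j} \<in> edges constraint_graph" "{Pth j, x} \<in> edges constraint_graph"
      if "x \<in> Ind ` {..<32}" "j \<in> {y, z}" for x j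
      using that yz unfolding constraint_graph_edge_iff by auto
    have PP: "{Pth y, Pth z} \<in> edges constraint_graph" "{Pth z, Pth y} \<in> edges constraint_graph"
      using yz unfolding constraint_graph_edge_iff by auto
    have E: "\<sigma> ` e \<in> edges constraint_graph" if "e \<in> base_edges m" for e
      using that assms vals IP PP
      by (auto simp: base_edges_def first_edges_def step_edges_def)
    have "{\<sigma> v, \<sigma> w} \<in> edges constraint_graph" if "{v, w} \<in> base_edges m" for v w
      using E[OF that] by simp
    then show "\<sigma> \<in> common_colorings m"
      using ext vals(1)
      by (force simp: common_colorings_def colorings_def verts_def[of "(_, _)"] edges_def[of "(_, _)"])
  qed
  have finP: "finite (P y z)" for y z
    using card_P[of y z] by (intro card_ge_0_finite) simp
  \<comment> \<open>The two families are told apart by the color of \<open>Vb 1\<close>, which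
    exists since \<open>m\<close> is at least 1.\<close>
  have disj: "P 1 2 \<inter> P 2 1 = {}"
  proof -
    have v: "Vb 1 \<in> base_verts m" using assms by (auto simp: base_verts_def)
    have "\<sigma> (Vb 1) = Pth y" if "\<sigma> \<in> P y z" for \<sigma> y z
      using PiE_mem[OF that[unfolded P_def] v] by simp
    from this[of _ 1 2] this[of _ 2 1] show ?thesis by fastforce
  qed
  have "2 * 1024 ^ m = card (P 1 2 \<union> P 2 1)"
    using card_Un_disjoint[OF finP finP disj] card_P by simp
  also have "\<dots> \<le> card (common_colorings m)"
  proof (rule card_mono)
    show "finite (common_colorings m)"
      using finite_base_colorings[of m "base_edges m"]
      by (rule finite_subset[rotated]) (auto simp: common_colorings_def)
    show "P 1 2 \<union> P 2 1 \<subseteq> common_colorings m"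
      using sub[of 1 2] sub[of 2 1] by blast
  qed
  finally show ?thesis .
qed

text \<open>If the class of the \<open>a\<close> vertices is not 0, only one vertex per layer is
  colored from the independent set, leaving at most \<open>2 ^ 2 * 2 * 32 = 256\<close> choices per
  layer. This is only an upper bound, as path vertices 1 and 4 lie in different classes without
  being adjacent.\<close>

lemma card_uncommon_colorings_le:
  "card (colorings constraint_graph (base_verts m, base_edges m) - common_colorings m) \<le> 4 * 256 ^ m"
    (is "card ?D \<le> _")
proof -
  define I where "I k = {x \<in> verts constraint_graph. color_class x = k}" for k
  define P where "P = (\<lambda>(x, y, z). PiE (base_verts m) (layer_pattern (I x) (I y) (I z)))"
  \<comment> \<open>The possible classes of \<open>a\<close>, \<open>b\<close>, \<open>c\<close>:
    permutations of 0, 1, 2 with nonzero first entry.\<close>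
  define Q :: "(nat \<times> nat \<times> nat) set" where "Q = {(1, 0, 2), (1, 2, 0), (2, 0, 1), (2, 1, 0)}"
  have card_I: "card (I 0) = 32" "card (I 1) = 2" "card (I 2) = 2"
    unfolding I_def color_class_fiber by (simp_all add: card_image inj_on_def)
  have card_P: "card (P q) = 256 ^ m" if "q \<in> Q" for q
    using that card_I unfolding P_def Q_def by (auto simp: card_PiE_layer_pattern)
  have "?D \<subseteq> \<Union> (P ` Q)"
  proof
    fix \<sigma> assume D: "\<sigma> \<in> ?D"
    then have \<sigma>: "\<sigma> \<in> colorings constraint_graph (base_verts m, base_edges m)" by simp
    let ?c = "\<lambda>v. color_class (\<sigma> v)"
    have ext: "\<sigma> \<in> base_verts m \<rightarrow>\<^sub>E verts constraint_graph"
      using \<sigma> by (auto simp: colorings_def verts_def[of "(_, _)"])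
    have "?c (Va 1) \<noteq> 0"
    proof
      assume "?c (Va 1) = 0"
      then have "\<forall>i\<in>{1..m}. ?c (Va i) = 0"
        using base_coloring_classes(1)[OF \<sigma>] by (metis atLeastAtMost_iff)
      with D show False by (simp add: common_colorings_def)
    qed
    then have Q: "(?c (Va 1), ?c (Vb 1), ?c (Vc 1)) \<in> Q"
      using base_coloring_triangle[OF \<sigma>] color_class_le_2[of "\<sigma> (Va 1)"]
        color_class_le_2[of "\<sigma> (Vb 1)"] color_class_le_2[of "\<sigma> (Vc 1)"]
      unfolding Q_def by auto
    have "\<sigma> \<in> P (?c (Va 1), ?c (Vb 1), ?c (Vc 1))"
      unfolding P_def prod.case
    proof (rule PiE_I)
      fix v assume v: "v \<in> base_verts m"
      then obtain i where i: "1 \<le> i" "i \<le> m" and "v \<in> {Va i, Va' i, Vb i, Vc i}"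
        unfolding base_verts_def by auto
      then have "?c v = layer_pattern (?c (Va 1)) (?c (Vb 1)) (?c (Vc 1)) v"
        using base_coloring_classes[OF \<sigma> i] by auto
      with PiE_mem[OF ext v]
      show "\<sigma> v \<in> layer_pattern (I (?c (Va 1))) (I (?c (Vb 1))) (I (?c (Vc 1))) v"
        by (cases v) (simp_all add: I_def)
    next
      fix v assume "v \<notin> base_verts m"
      then show "\<sigma> v = undefined" using ext by auto
    qed
    with Q show "\<sigma> \<in> \<Union> (P ` Q)" by blast
  qed
  moreover have "finite (\<Union> (P ` Q))"
    using card_P by (intro finite_UN_I card_ge_0_finite) (auto simp: Q_def)
  ultimately have "card ?D \<le> card (\<Union> (P ` Q))"
    by (intro card_mono)
  also have "\<dots> \<le> (\<Sum>q\<in>Q. card (P q))"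
    by (rule card_UN_le) (simp add: Q_def)
  also have "\<dots> = 4 * 256 ^ m"
    using card_P by (simp add: Q_def)
  finally show ?thesis .
qed

section \<open>The size of the graph family\<close>

lemma graph_family_eq:
  "graph_family (4 * m) = (\<lambda>S. (base_verts m, base_edges m \<union> S)) ` Pow (optional_edges m)"
  unfolding graph_family_def by force

text \<open>Different sets of optional edges give different graphs, since no optional edge is a base
  edge: the indices of its ends differ by 2, those of a base edge by at most 1.\<close>

lemma
  assumes "m \<ge> 2"
  shows finite_graph_family: "finite (graph_family (4 * m))"
    and card_graph_family: "card (graph_family (4 * m)) = 2 ^ (m - 2)"
proof -
  let ?g = "\<lambda>S. (base_verts m, base_edges m \<union> S)"
  have opt: "optional_edges m = (\<lambda>i. {Va i, Vb (i + 2)}) ` {1..m - 2}"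
  proof (intro equalityI subsetI)
    fix e assume "e \<in> optional_edges m"
    then obtain i where "e = {Va i, Vb (i + 2)}" "1 \<le> i" "i + 2 \<le> m"
      unfolding optional_edges_def by blast
    then show "e \<in> (\<lambda>i. {Va i, Vb (i + 2)}) ` {1..m - 2}" by (intro image_eqI[of _ _ i]) auto
  next
    fix e assume "e \<in> (\<lambda>i. {Va i, Vb (i + 2)}) ` {1..m - 2}"
    then obtain i where "e = {Va i, Vb (i + 2)}" "1 \<le> i" "i \<le> m - 2" by auto
    moreover from this have "i + 2 \<le> m" using assms by linarith
    ultimately show "e \<in> optional_edges m" unfolding optional_edges_def by blast
  qed
  have card_opt: "card (optional_edges m) = m - 2" and fin: "finite (optional_edges m)"
    unfolding opt by (subst card_image) (auto simp: inj_on_def doubleton_eq_iff)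
  have disj: "optional_edges m \<inter> base_edges m = {}"
  proof -
    have "{Va i, Vb (i + 2)} \<notin> first_edges" "{Va i, Vb (i + 2)} \<notin> step_edges j" for i j
      by (simp_all add: first_edges_def step_edges_def doubleton_eq_iff)
    then show ?thesis unfolding optional_edges_def base_edges_def by blast
  qed
  have "inj_on ?g (Pow (optional_edges m))"
    using disj by (intro inj_onI) blast
  then show "card (graph_family (4 * m)) = 2 ^ (m - 2)"
    unfolding graph_family_eq by (simp add: card_image card_Pow fin card_opt)
  show "finite (graph_family (4 * m))"
    unfolding graph_family_eq using fin by simp
qed

section \<open>The lower bound on the number of samples\<close>

theorem theorem5:
  fixes m n L :: nat
    and A :: "(vertex \<Rightarrow> color) list \<Rightarrow> vertex graph pmf"
  assumes "m \<ge> 2"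
    and "n = 4 * m"
    and "structure_learning_algorithm constraint_graph (graph_family n) L A"
    and "succeeds_with_prob constraint_graph (graph_family n) L A (2 powi (- (int m - 3)))"
  shows "L \<ge> 2 ^ (m + 1)"
proof -
  let ?\<G> = "graph_family (4 * m)" and ?T = "common_colorings m"
  let ?\<Omega> = "colorings constraint_graph"
  \<comment> \<open>Writing \<open>m\<close> as \<open>N + 2\<close> removes truncated subtraction
    from the exponents.\<close>
  define N where "N = m - 2"
  have m: "m = N + 2" using assms(1) by (simp add: N_def)
  have T: "2 * 1024 ^ m \<le> card ?T"
    using assms(1) by (intro card_common_colorings_ge) simp
  have "finite (?\<Omega> G) \<and> ?T \<subseteq> ?\<Omega> G \<and> ?\<Omega> G \<subseteq> ?\<Omega> (base_verts m, base_edges m)"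
    if G_in: "G \<in> ?\<G>" for G
  proof -
    obtain S where G: "G = (base_verts m, base_edges m \<union> S)" and S: "S \<subseteq> optional_edges m"
      using G_in unfolding graph_family_eq by blast
    show ?thesis
      unfolding G
    proof (intro conjI finite_base_colorings common_colorings_subset S)
      show "?\<Omega> (base_verts m, base_edges m \<union> S) \<subseteq> ?\<Omega> (base_verts m, base_edges m)"
        by (auto simp: colorings_def verts_def[of "(_, _)"] edges_def[of "(_, _)"])
    qed
  qed
  note \<Omega> = this
  have fin: "finite ?T" and ne: "?T \<noteq> {}"
    using T by (auto intro!: card_ge_0_finite intro: less_le_trans[rotated])
  \<comment> \<open>The factor is the ratio of the two counts,
    \<open>4 * 256 ^ m / (2 * 1024 ^ m)\<close>.\<close>
  have \<epsilon>: "card (?\<Omega> G - ?T) \<le> (2 / 4 ^ m) * card ?T" if "G \<in> ?\<G>" for G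
  proof -
    have "card (?\<Omega> G - ?T) \<le> card (?\<Omega> (base_verts m, base_edges m) - ?T)"
      using \<Omega>[OF that] finite_base_colorings by (intro card_mono) auto
    also have "\<dots> \<le> 4 * 256 ^ m" by (rule card_uncommon_colorings_le)
    finally have "real (card (?\<Omega> G - ?T)) \<le> real (4 * 256 ^ m)"
      by (simp only: of_nat_le_iff)
    also have "\<dots> = (2 / 4 ^ m) * real (2 * 1024 ^ m)"
    proof -
      have "(1024::real) ^ m = 4 ^ m * 256 ^ m" by (simp flip: power_mult_distrib)
      then show ?thesis by simp
    qed
    also have "\<dots> \<le> (2 / 4 ^ m) * real (card ?T)"
      using T by (intro mult_left_mono) (simp_all only: of_nat_le_iff, simp)
    finally show ?thesis .
  qed
  \<comment> \<open>The number of graphs times the required success probability; the excess of 2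
    over the 1 granted by common colorings must come from the other samples.\<close>
  have "(2::real) = 2 ^ N * 2 powi (- (int m - 3))"
    by (simp add: m power_int_diff)
  also have "\<dots> = (\<Sum>G\<in>?\<G>. 2 powi (- (int m - 3)))"
    using card_graph_family[OF assms(1)] by (simp add: N_def)
  also have "\<dots> \<le> (\<Sum>G\<in>?\<G>. pmf (bind_pmf (replicate_pmf L (pmf_of_set (?\<Omega> G))) A) G)"
    using assms(2,4)
    by (intro sum_mono)
      (auto simp: succeeds_with_prob_def output_pmf_def coloring_pmf_def measure_pmf_single)
  also have "\<dots> \<le> 1 + card ?\<G> * (L * (2 / 4 ^ m))"
    using finite_graph_family[OF assms(1)] \<Omega> fin ne \<epsilon> by (intro sum_identification_prob_le) auto
  also have "\<dots> = 1 + 2 ^ N * (L * (2 / 4 ^ m))"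
    using card_graph_family[OF assms(1)] by (simp add: N_def)
  finally have "4 ^ m \<le> 2 ^ N * 2 * real L"
    by (simp add: field_simps)
  \<comment> \<open>The exponents of 2 agree: \<open>N + 1 + (m + 1) = 2 * m\<close>.\<close>
  moreover have "(4::real) ^ m = 2 ^ N * 2 * 2 ^ (m + 1)"
  proof -
    have "(4::real) ^ N = 2 ^ N * 2 ^ N" by (simp flip: power_mult_distrib)
    then show ?thesis by (simp add: m)
  qed
  ultimately have "2 ^ (m + 1) \<le> real L" by simp
  then have "real (2 ^ (m + 1)) \<le> real L" by simp
  then show ?thesis by (simp only: of_nat_le_iff)
qed

end
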